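(* For every integer $n \geq 3$, Left wins the Classic Variant of the Mixed Deletion Game played on the complete graph $K_n$.
   Context: The Classic Variant of the Mixed Deletion Game is a two-player combinatorial game between Left and Right played on a finite simple undirected graph; players alternate turns. On her turn Left deletes one vertex together with all edges incident to it; on his turn Right deletes one edge. The game ends when a deletion creates an isolated vertex (a vertex of degree $0$), and the player whose deletion created an isolated vertex loses; thus a legal move is a deletion which does not create an isolated vertex, and a player with no legal move loses. $K_n$ denotes the complete graph on $n$ vertices. *)

theory Defs
  imports Main
begin

type_synonym 'a ugraph = "'a set \<times> 'a set set"

abbreviation verts :: "'a ugraph \<Rightarrow> 'a set" where "verts \<equiv> fst"
abbreviation edges :: "'a ugraph \<Rightarrow> 'a set set" where "edges \<equiv> snd"

definition finite_simple_graph :: "'a ugraph \<Rightarrow> bool" where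
  "finite_simple_graph G \<longleftrightarrow>
     finite (verts G) \<and> (\<forall>e \<in> edges G. e \<subseteq> verts G \<and> card e = 2)"

definition complete_graph :: "'a set \<Rightarrow> 'a ugraph" where
  "complete_graph V = (V, {e. e \<subseteq> V \<and> card e = 2})"

definition degree :: "'a ugraph \<Rightarrow> 'a \<Rightarrow> nat" where
  "degree G v = card {e \<in> edges G. v \<in> e}"

definition isolated :: "'a ugraph \<Rightarrow> 'a \<Rightarrow> bool" where
  "isolated G v \<longleftrightarrow> v \<in> verts G \<and> degree G v = 0"

definition delete_vertex :: "'a ugraph \<Rightarrow> 'a \<Rightarrow> 'a ugraph" where
  "delete_vertex G v = (verts G - {v}, {e \<in> edges G. v \<notin> e})"

definition delete_edge :: "'a ugraph \<Rightarrow> 'a set \<Rightarrow> 'a ugraph" where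
  "delete_edge G e = (verts G, edges G - {e})"

datatype player = Left | Right

fun opponent :: "player \<Rightarrow> player" where
  "opponent Left = Right"
| "opponent Right = Left"

text \<open>\<open>deletion p G H\<close>: player \<open>p\<close> can turn \<open>G\<close> into \<open>H\<close> by a single deletion, legal or not.\<close>

fun deletion :: "player \<Rightarrow> 'a ugraph \<Rightarrow> 'a ugraph \<Rightarrow> bool" where
  "deletion Left G H \<longleftrightarrow> (\<exists>v \<in> verts G. H = delete_vertex G v)"
| "deletion Right G H \<longleftrightarrow> (\<exists>e \<in> edges G. H = delete_edge G e)"

definition creates_isolated :: "'a ugraph \<Rightarrow> 'a ugraph \<Rightarrow> bool" where
  "creates_isolated G H \<longleftrightarrow> (\<exists>v. isolated H v \<and> \<not> isolated G v)"

definition legal_move :: "player \<Rightarrow> 'a ugraph \<Rightarrow> 'a ugraph \<Rightarrow> bool" where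
  "legal_move p G H \<longleftrightarrow> deletion p G H \<and> \<not> creates_isolated G H"

text \<open>
  \<open>has_winning_strategy p q G\<close>: player \<open>p\<close> can force a win from position \<open>G\<close> when player \<open>q\<close>
  is to move. A player without a legal move loses: \<open>own_turn\<close> demands a legal move, and
  \<open>opponents_turn\<close> holds vacuously if the opponent has none. The least fixed point is the right
  one because every move on a finite graph shrinks it, so there are no infinite plays.
\<close>

inductive has_winning_strategy :: "player \<Rightarrow> player \<Rightarrow> 'a ugraph \<Rightarrow> bool" for p :: player where
  own_turn: "legal_move p G H \<Longrightarrow> has_winning_strategy p (opponent p) H
    \<Longrightarrow> has_winning_strategy p p G"
| opponents_turn: "(\<And>H. legal_move (opponent p) G H \<Longrightarrow> has_winning_strategy p p H)
    \<Longrightarrow> has_winning_strategy p (opponent p) G"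

text \<open>A player wins the game on \<open>G\<close>, without further qualification, if that player can force a
  win no matter who makes the first move.\<close>

definition wins_game :: "player \<Rightarrow> 'a ugraph \<Rightarrow> bool" where
  "wins_game p G \<longleftrightarrow> (\<forall>first. has_winning_strategy p first G)"

lemma finite_simple_graph_complete_graph:
  "finite V \<Longrightarrow> finite_simple_graph (complete_graph V)"
  by (simp add: finite_simple_graph_def complete_graph_def)

lemma finite_simple_graph_deletion:
  assumes "finite_simple_graph G" "deletion p G H"
  shows "finite_simple_graph H"
proof (cases p)
  case Left
  with assms show ?thesis
    by (simp add: finite_simple_graph_def delete_vertex_def) fastforce
next
  case Right
  with assms show ?thesis
    by (fastforce simp: finite_simple_graph_def delete_edge_def)
qed

end

(* Left keeps a dominating vertex u: if Right deletes an edge {u, w}, Left answers by deleting w,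
   and otherwise Left deletes any vertex other than u. A graph with a dominating vertex and at
   least two vertices has no isolated vertex, so these answers are legal as long as at least three
   vertices are left; with two vertices left, Right has no legal move. *)
theory Submission
  imports Defs
begin

definition dominating :: "'a ugraph \<Rightarrow> 'a \<Rightarrow> bool" where
  "dominating G u \<longleftrightarrow> u \<in> verts G \<and> (\<forall>v \<in> verts G - {u}. {u, v} \<in> edges G)"

lemma finite_edges:
  assumes "finite_simple_graph G"
  shows "finite (edges G)"
proof (rule finite_subset)
  show "edges G \<subseteq> Pow (verts G)" "finite (Pow (verts G))"
    using assms by (auto simp: finite_simple_graph_def)
qed

text \<open>Finiteness matters here: an infinite set has \<open>card\<close> 0, so
  \<open>degree G v = 0\<close> by itself would not exclude edges at \<open>v\<close>.\<close>

lemma isolated_iff: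
  assumes "finite_simple_graph G"
  shows "isolated G v \<longleftrightarrow> v \<in> verts G \<and> (\<forall>e \<in> edges G. v \<notin> e)"
  using finite_edges[OF assms] by (auto simp: isolated_def degree_def)

lemma card_ge_2_obtains_other:
  assumes "card A \<ge> 2"
  obtains w where "w \<in> A" "w \<noteq> u"
proof -
  have "\<not> A \<subseteq> {u}"
    using assms card_mono[of "{u}" A] by auto
  then show thesis
    using that by blast
qed

lemma dominating_not_isolated:
  assumes G: "finite_simple_graph G" and u: "dominating G u" and "card (verts G) \<ge> 2"
  shows "\<not> isolated G v"
proof
  assume v: "isolated G v"
  obtain w where "w \<in> verts G" "w \<noteq> u"
    using assms(3) by (rule card_ge_2_obtains_other)
  with u v show False
    by (cases "v = u") (auto simp: isolated_iff[OF G] dominating_def)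
qed

lemma dominating_delete_vertex:
  assumes "dominating G u" "w \<noteq> u"
  shows "dominating (delete_vertex G w) u"
  using assms by (auto simp: dominating_def delete_vertex_def)

text \<open>The only adjacency of \<open>u\<close> that the edge deletion can destroy is the one to
  \<open>w\<close>, and \<open>w\<close> leaves the graph right afterwards.\<close>

lemma dominating_delete_edge_vertex:
  assumes "dominating G u" "w \<noteq> u" "u \<in> e \<Longrightarrow> e = {u, w}"
  shows "dominating (delete_vertex (delete_edge G e) w) u"
  using assms by (auto simp: dominating_def delete_vertex_def delete_edge_def)

lemma card_delete_vertex:
  assumes "finite_simple_graph G" "w \<in> verts G"
  shows "card (verts G) = Suc (card (verts (delete_vertex G w)))"
  using assms card_Suc_Diff1[of "verts G" w]
  by (auto simp: finite_simple_graph_def delete_vertex_def)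

text \<open>Induction on the number of vertices: Right's move keeps it and Left's reply lowers it by
  one, so after each full round the same invariant holds on a smaller graph with Right to move
  again.\<close>

lemma Left_wins_dominating_Right_moves:
  assumes "finite_simple_graph G" "dominating G u" "card (verts G) \<ge> 2"
  shows "has_winning_strategy Left Right G"
  using assms
proof (induction "card (verts G)" arbitrary: G rule: less_induct)
  case less
  note G = \<open>finite_simple_graph G\<close> and u = \<open>dominating G u\<close>
  have "has_winning_strategy Left Left H" if H: "legal_move Right G H" for H
  proof -
    obtain e where e: "e \<in> edges G" and H_def: "H = delete_edge G e"
      using H by (auto simp: legal_move_def)
    have vH: "verts H = verts G"
      by (simp add: H_def delete_edge_def)
    have finH: "finite_simple_graph H"
      using G H finite_simple_graph_deletion legal_move_def by blast
    have eG: "e \<subseteq> verts G" "card e = 2"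
      using G e by (auto simp: finite_simple_graph_def)
    \<comment> \<open>The vertex for Left's reply is an endpoint of \<open>e\<close> other than
      \<open>u\<close>: the only such one if \<open>u\<close> lies in \<open>e\<close>, either one
      otherwise.\<close>
    obtain w where w: "w \<in> verts G" "w \<noteq> u" "u \<in> e \<Longrightarrow> e = {u, w}"
    proof (cases "u \<in> e")
      case True
      with eG show thesis
        by (auto simp: card_2_iff intro: that)
    next
      case False
      with eG show thesis
        by (auto simp: card_2_iff intro: that)
    qed
    \<comment> \<open>On two vertices \<open>e\<close> is the only edge, so deleting it would
      isolate \<open>u\<close>, which was not isolated before; this contradicts the legality of
      Right's move.\<close>
    have "card (verts G) \<noteq> 2"
    proof
      assume "card (verts G) = 2"
      then have V: "e = verts G"
        using eG by (metis card_subset_eq card.infinite zero_neq_numeral)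
      have "e' = e" if "e' \<in> edges G" for e'
        using that G V by (metis finite_simple_graph_def card_subset_eq \<open>card (verts G) = 2\<close>)
      then have "isolated H u"
        using u unfolding isolated_iff[OF finH]
        by (auto simp: H_def delete_edge_def dominating_def)
      with H dominating_not_isolated[OF G u less.prems(3)] show False
        by (auto simp: legal_move_def creates_isolated_def)
    qed
    \<comment> \<open>A third vertex ensures that two remain after Left's reply, as both the
      induction hypothesis and \<open>dominating_not_isolated\<close> require.\<close>
    with less.prems(3) have card3: "card (verts G) \<ge> 3" by simp
    let ?H' = "delete_vertex H w"
    have del: "deletion Left H ?H'"
      using w vH by auto
    have finH': "finite_simple_graph ?H'"
      using finite_simple_graph_deletion[OF finH del] .
    have card: "card (verts G) = Suc (card (verts ?H'))"
      using card_delete_vertex[OF finH] w vH by simp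
    have dom: "dominating ?H' u"
      unfolding H_def by (rule dominating_delete_edge_vertex[OF u w(2,3)])
    have "has_winning_strategy Left Right ?H'"
      using less.hyps finH' dom card card3 by simp
    moreover have "legal_move Left H ?H'"
      using del dominating_not_isolated[OF finH' dom] card card3
      by (simp add: legal_move_def creates_isolated_def)
    ultimately show ?thesis
      by (auto intro: own_turn)
  qed
  \<comment> \<open>If Right has no legal move, the rule applies vacuously and Left has won.\<close>
  then show ?case
    using opponents_turn[of Left G] by simp
qed

theorem theorem3p7:
  fixes V :: "'a set" and n :: nat
  assumes "n \<ge> 3" and "finite V" and "card V = n"
  shows "wins_game Left (complete_graph V)"
proof -
  let ?K = "complete_graph V"
  have K: "finite_simple_graph ?K" "verts ?K = V"
    using finite_simple_graph_complete_graph[OF assms(2)] by (simp_all add: complete_graph_def)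
  have dom: "dominating ?K u" if "u \<in> V" for u
    using that by (auto simp: dominating_def complete_graph_def card_2_iff)
  obtain u where "u \<in> V"
    using assms by fastforce
  moreover obtain w where "w \<in> V" "w \<noteq> u"
    using assms card_ge_2_obtains_other[of V u] by auto
  ultimately have uw: "u \<in> V" "w \<in> V" "w \<noteq> u" .
  have "has_winning_strategy Left Right ?K"
    using Left_wins_dominating_Right_moves[OF K(1) dom[OF uw(1)]] K assms by simp
  \<comment> \<open>Going first, Left spends one vertex before the lemma applies; starting from at
    least three leaves the two that it demands.\<close>
  moreover have "has_winning_strategy Left Left ?K"
  proof -
    let ?H = "delete_vertex ?K w"
    have del: "deletion Left ?K ?H"
      using uw K by auto
    have H: "finite_simple_graph ?H" "dominating ?H u" "card (verts ?H) \<ge> 2"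
      using finite_simple_graph_deletion[OF K(1) del] dominating_delete_vertex[OF dom] uw
        card_delete_vertex[OF K(1), of w] K(2) assms by auto
    have "legal_move Left ?K ?H"
      using del dominating_not_isolated[OF H] by (simp add: legal_move_def creates_isolated_def)
    with Left_wins_dominating_Right_moves[OF H] show ?thesis
      by (auto intro: own_turn)
  qed
  ultimately show ?thesis
    unfolding wins_game_def by (metis player.exhaust)
qed

end
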